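(* The push maps $\tau:\mathrm{Mould}(n)\to\mathrm{Mould}(n)$ and the composition maps $\circ_i:\mathrm{Mould}(m)\otimes\mathrm{Mould}(n)\to\mathrm{Mould}(m+n-1)$ ($1\le i\le m$) defined in the context, with unit $\mathbf 1=1/u_1\in\mathrm{Mould}(1)$, define the structure of an anticyclic non-symmetric operad on the collection $\mathrm{Mould}=(\mathrm{Mould}(n))_{n\ge 1}$.
   Context: For $n\ge1$, $\mathrm{Mould}(n)$ is the $\mathbb{Q}$-vector space of rational functions with rational coefficients in the variables $u_1,\dots,u_n$. Notation: $u_{i\dots j}=\sum_{i\le k\le j}u_k$. The push: for $f\in\mathrm{Mould}(n)$, $\tau(f)(u_1,\dots,u_n)=f(-u_{1\dots n},u_1,\dots,u_{n-1})$. Composition: for $f\in\mathrm{Mould}(m)$, $g\in\mathrm{Mould}(n)$, $1\le i\le m$, $$f\circ_i g=u_{i\dots i+n-1}\,f(u_1,\dots,u_{i-1},u_{i\dots i+n-1},u_{i+n},\dots,u_{m+n-1})\,g(u_i,\dots,u_{i+n-1}).$$ A non-symmetric operad (in vector spaces) is a collection $(P(n))_{n\ge1}$ of vector spaces with $\mathbf 1\in P(1)$ and bilinear maps $\circ_i:P(m)\otimes P(n)\to P(m+n-1)$, $1\le i\le m$, such that $\mathbf 1\circ_1 f=f$, $f\circ_i\mathbf 1=f$, and for $f\in P(m),g\in P(n),h\in P(p)$: $(f\circ_i g)\circ_{j+n-1}h=(f\circ_j h)\circ_i g$ for $1\le i<j\le m$, and $f\circ_i(g\circ_j h)=(f\circ_i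 g)\circ_{j+i-1}h$ for $1\le i\le m$, $1\le j\le n$. An anticyclic non-symmetric operad is a non-symmetric operad with linear maps $\tau:P(n)\to P(n)$ such that $\tau^{n+1}=\mathrm{id}$ on $P(n)$, $\tau(\mathbf 1)=-\mathbf 1$, and for $f\in P(m)$, $g\in P(n)$: $\tau(f\circ_i g)=\tau(f)\circ_{i-1}g$ for $2\le i\le m$, and $\tau(f\circ_1 g)=-\tau(g)\circ_n\tau(f)$. *)

theory Defs
  imports Complex_Main "HOL-Library.Poly_Mapping" "HOL-Computational_Algebra.Fraction_Field"
begin

section \<open>Rational functions and substitution\<close>

text \<open>
  Polynomials over the rationals in variables indexed by \<^typ>\<open>nat\<close>: a monomial is a finitely
  supported exponent vector \<^typ>\<open>nat \<Rightarrow>\<^sub>0 nat\<close>, a polynomial a finitely supported family of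
  coefficients indexed by monomials.
\<close>

type_synonym qpoly = "(nat \<Rightarrow>\<^sub>0 nat) \<Rightarrow>\<^sub>0 rat"
type_synonym qrat = "qpoly fract"

definition const :: "rat \<Rightarrow> qrat" where
  "const c = Fract (Poly_Mapping.single 0 c) 1"

definition u :: "nat \<Rightarrow> qrat" where
  "u k = Fract (Poly_Mapping.single (Poly_Mapping.single k 1) 1) 1"

definition mould_scale :: "rat \<Rightarrow> qrat \<Rightarrow> qrat" where
  "mould_scale c f = const c * f"

definition vars :: "qpoly \<Rightarrow> nat set" where
  "vars p = (\<Union>m\<in>Poly_Mapping.keys p. Poly_Mapping.keys m)"

definition mon_subst :: "(nat \<Rightarrow> qrat) \<Rightarrow> (nat \<Rightarrow>\<^sub>0 nat) \<Rightarrow> qrat" where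
  "mon_subst s m = (\<Prod>k\<in>Poly_Mapping.keys m. s k ^ Poly_Mapping.lookup m k)"

definition poly_subst :: "(nat \<Rightarrow> qrat) \<Rightarrow> qpoly \<Rightarrow> qrat" where
  "poly_subst s p =
    (\<Sum>m\<in>Poly_Mapping.keys p. const (Poly_Mapping.lookup p m) * mon_subst s m)"

text \<open>
  \<open>rat_subst s f\<close> is \<open>f\<close> with \<open>s k\<close> substituted for each variable \<open>u k\<close>. It is meaningful
  whenever \<open>f\<close> can be written with a denominator that does not vanish under the substitution;
  the value does not depend on the fraction chosen (lemma \<open>rat_subst_Fract\<close> below).
\<close>

definition rat_subst :: "(nat \<Rightarrow> qrat) \<Rightarrow> qrat \<Rightarrow> qrat" where
  "rat_subst s f =
    (THE y. \<exists>p q. f = Fract p q \<and> poly_subst s q \<noteq> 0 \<and> y = poly_subst s p / poly_subst s q)"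

lemma const_add: "const (a + b) = const a + const b"
  by (simp add: const_def single_add)

lemma const_mult: "const (a * b) = const a * const b"
  by (simp add: const_def mult_single)

lemma const_0 [simp]: "const 0 = 0"
  by (simp add: const_def Zero_fract_def)

lemma poly_subst_0 [simp]: "poly_subst s 0 = 0"
  by (simp add: poly_subst_def)

lemma poly_subst_add: "poly_subst s (p + q) = poly_subst s p + poly_subst s q"
  unfolding poly_subst_def
  by (rule setsum_keys_plus_distrib) (simp_all add: const_add algebra_simps)

lemma poly_subst_single: "poly_subst s (Poly_Mapping.single m c) = const c * mon_subst s m"
  by (simp add: poly_subst_def)

lemma mon_subst_superset:
  assumes "finite A" "Poly_Mapping.keys m \<subseteq> A"
  shows "mon_subst s m = (\<Prod>k\<in>A. s k ^ Poly_Mapping.lookup m k)"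
  unfolding mon_subst_def using assms
  by (intro prod.mono_neutral_left) (auto simp: in_keys_iff)

lemma mon_subst_add: "mon_subst s (m + m') = mon_subst s m * mon_subst s m'"
proof -
  let ?A = "Poly_Mapping.keys m \<union> Poly_Mapping.keys m'"
  have "Poly_Mapping.keys (m + m') \<subseteq> ?A" by (rule keys_add)
  then show ?thesis
    by (simp add: mon_subst_superset[of ?A] lookup_add power_add prod.distrib)
qed

lemma update_eq_single_add:
  fixes f :: qpoly
  assumes "a \<notin> Poly_Mapping.keys f"
  shows "Poly_Mapping.update a b f = Poly_Mapping.single a b + f"
  using assms
  by (intro poly_mapping_eqI) (auto simp: lookup_update lookup_add lookup_single when_def in_keys_iff)

lemma poly_subst_mult: "poly_subst s (p * q) = poly_subst s p * poly_subst s q"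
proof -
  have single: "poly_subst s (Poly_Mapping.single m c * q)
    = poly_subst s (Poly_Mapping.single m c) * poly_subst s q" for m c
  proof (induction q rule: update_induct)
    case const
    show ?case by simp
  next
    case (update f a b)
    then show ?case
      by (simp add: update_eq_single_add distrib_left poly_subst_add mult_single
        poly_subst_single const_mult mon_subst_add)
  qed
  show ?thesis
  proof (induction p rule: update_induct)
    case const
    show ?case by simp
  next
    case (update f a b)
    then show ?case
      by (simp add: update_eq_single_add distrib_right poly_subst_add single)
  qed
qed

lemma rat_subst_Fract:
  assumes q: "poly_subst s q \<noteq> 0"
  shows "rat_subst s (Fract p q) = poly_subst s p / poly_subst s q"
  unfolding rat_subst_def
proof (rule the_equality)
  show "\<exists>p' q'. Fract p q = Fract p' q' \<and> poly_subst s q' \<noteq> 0 \<and>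
      poly_subst s p / poly_subst s q = poly_subst s p' / poly_subst s q'"
    using q by blast
next
  fix y
  assume "\<exists>p' q'. Fract p q = Fract p' q' \<and> poly_subst s q' \<noteq> 0 \<and>
      y = poly_subst s p' / poly_subst s q'"
  then obtain p' q' where eq: "Fract p q = Fract p' q'" and q': "poly_subst s q' \<noteq> 0"
    and y: "y = poly_subst s p' / poly_subst s q'" by blast
  have "q \<noteq> 0" "q' \<noteq> 0" using q q' by auto
  with eq have "p * q' = p' * q" by (simp add: eq_fract)
  then have "poly_subst s p * poly_subst s q' = poly_subst s p' * poly_subst s q"
    by (metis poly_subst_mult)
  then show "y = poly_subst s p / poly_subst s q"
    using q q' y by (simp add: frac_eq_eq)
qed

section \<open>Anticyclic non-symmetric operads\<close>

text \<open>
  The spaces \<open>P n\<close> (\<open>n \<ge> 1\<close>) are subspaces of one ambient vector space. They need not be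
  disjoint or independent, so \<open>circ m n i\<close>, the map \<open>P m \<otimes> P n \<rightarrow> P (m + n - 1)\<close>, and \<open>tau n\<close>
  carry their arities as arguments. Only values on these subspaces are constrained.
\<close>

locale ns_operad = vector_space scale
  for scale :: "'k::field \<Rightarrow> 'v::ab_group_add \<Rightarrow> 'v" +
  fixes P :: "nat \<Rightarrow> 'v set"
    and unit :: 'v
    and circ :: "nat \<Rightarrow> nat \<Rightarrow> nat \<Rightarrow> 'v \<Rightarrow> 'v \<Rightarrow> 'v"
  assumes subspace_P: "1 \<le> n \<Longrightarrow> subspace (P n)"
    and unit_in: "unit \<in> P 1"
    and circ_in: "\<lbrakk>1 \<le> i; i \<le> m; 1 \<le> n; f \<in> P m; g \<in> P n\<rbrakk> \<Longrightarrow> circ m n i f g \<in> P (m + n - 1)"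
    and circ_add_left: "\<lbrakk>1 \<le> i; i \<le> m; 1 \<le> n; f \<in> P m; f' \<in> P m; g \<in> P n\<rbrakk>
      \<Longrightarrow> circ m n i (f + f') g = circ m n i f g + circ m n i f' g"
    and circ_add_right: "\<lbrakk>1 \<le> i; i \<le> m; 1 \<le> n; f \<in> P m; g \<in> P n; g' \<in> P n\<rbrakk>
      \<Longrightarrow> circ m n i f (g + g') = circ m n i f g + circ m n i f g'"
    and circ_scale_left: "\<lbrakk>1 \<le> i; i \<le> m; 1 \<le> n; f \<in> P m; g \<in> P n\<rbrakk>
      \<Longrightarrow> circ m n i (scale c f) g = scale c (circ m n i f g)"
    and circ_scale_right: "\<lbrakk>1 \<le> i; i \<le> m; 1 \<le> n; f \<in> P m; g \<in> P n\<rbrakk>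
      \<Longrightarrow> circ m n i f (scale c g) = scale c (circ m n i f g)"
    and circ_unit_left: "\<lbrakk>1 \<le> n; f \<in> P n\<rbrakk> \<Longrightarrow> circ 1 n 1 unit f = f"
    and circ_unit_right: "\<lbrakk>1 \<le> i; i \<le> m; f \<in> P m\<rbrakk> \<Longrightarrow> circ m 1 i f unit = f"
    and circ_parallel: "\<lbrakk>1 \<le> i; i < j; j \<le> m; 1 \<le> n; 1 \<le> p; f \<in> P m; g \<in> P n; h \<in> P p\<rbrakk>
      \<Longrightarrow> circ (m + n - 1) p (j + n - 1) (circ m n i f g) h
        = circ (m + p - 1) n i (circ m p j f h) g"
    and circ_nested: "\<lbrakk>1 \<le> i; i \<le> m; 1 \<le> j; j \<le> n; 1 \<le> p; f \<in> P m; g \<in> P n; h \<in> P p\<rbrakk>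
      \<Longrightarrow> circ m (n + p - 1) i f (circ n p j g h)
        = circ (m + n - 1) p (j + i - 1) (circ m n i f g) h"

locale anticyclic_ns_operad = ns_operad scale P unit circ
  for scale :: "'k::field \<Rightarrow> 'v::ab_group_add \<Rightarrow> 'v"
    and P :: "nat \<Rightarrow> 'v set"
    and unit :: 'v
    and circ :: "nat \<Rightarrow> nat \<Rightarrow> nat \<Rightarrow> 'v \<Rightarrow> 'v \<Rightarrow> 'v" +
  fixes tau :: "nat \<Rightarrow> 'v \<Rightarrow> 'v"
  assumes tau_in: "\<lbrakk>1 \<le> n; f \<in> P n\<rbrakk> \<Longrightarrow> tau n f \<in> P n"
    and tau_add: "\<lbrakk>1 \<le> n; f \<in> P n; g \<in> P n\<rbrakk> \<Longrightarrow> tau n (f + g) = tau n f + tau n g"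
    and tau_scale: "\<lbrakk>1 \<le> n; f \<in> P n\<rbrakk> \<Longrightarrow> tau n (scale c f) = scale c (tau n f)"
    and tau_power: "\<lbrakk>1 \<le> n; f \<in> P n\<rbrakk> \<Longrightarrow> (tau n ^^ (n + 1)) f = f"
    and tau_unit: "tau 1 unit = - unit"
    and tau_circ: "\<lbrakk>2 \<le> i; i \<le> m; 1 \<le> n; f \<in> P m; g \<in> P n\<rbrakk>
      \<Longrightarrow> tau (m + n - 1) (circ m n i f g) = circ m n (i - 1) (tau m f) g"
    and tau_circ_1: "\<lbrakk>1 \<le> m; 1 \<le> n; f \<in> P m; g \<in> P n\<rbrakk>
      \<Longrightarrow> tau (m + n - 1) (circ m n 1 f g) = - circ n m n (tau n g) (tau m f)"

section \<open>Moulds\<close>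

text \<open>\<open>Mould n\<close> is the subfield generated by \<open>u 1, \<dots>, u n\<close> of the field of rational functions in
  all the variables.\<close>

definition Mould :: "nat \<Rightarrow> qrat set" where
  "Mould n = {Fract p q | p q. q \<noteq> 0 \<and> vars p \<subseteq> {1..n} \<and> vars q \<subseteq> {1..n}}"

definition push :: "nat \<Rightarrow> qrat \<Rightarrow> qrat" where
  "push n f = rat_subst (\<lambda>k. if k = 1 then - (\<Sum>l=1..n. u l) else u (k - 1)) f"

text \<open>The arity \<open>m\<close> of the first argument does not enter the formula; it is a parameter only to fit
  the shape of composition maps in \<^locale>\<open>ns_operad\<close>.\<close>

definition mould_circ :: "nat \<Rightarrow> nat \<Rightarrow> nat \<Rightarrow> qrat \<Rightarrow> qrat \<Rightarrow> qrat" where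
  "mould_circ m n i f g =
    (\<Sum>l=i..i+n-1. u l)
    * rat_subst (\<lambda>k. if k < i then u k else if k = i then (\<Sum>l=i..i+n-1. u l) else u (k + n - 1)) f
    * rat_subst (\<lambda>k. u (i + k - 1)) g"

definition mould_unit :: qrat where
  "mould_unit = 1 / u 1"

end

theory Submission
  imports Defs
begin

text \<open>
  Composition and push are built from substitutions: each replaces the variables of a mould by
  signed sums of consecutive variables. Each such substitution, restricted to the variables of its
  argument, has a left inverse that is again a substitution of polynomials
  (\<open>alg_indep_left_inverse\<close>). Hence it annihilates no nonzero denominator and is an embedding of
  fields. In particular, successive substitutions compose (\<open>rat_subst_comp\<close>).

  Every axiom then says that two products of substituted moulds agree. Carrying an outer
  substitution through a composition (\<open>rat_subst_mould_circ\<close>) turns both sides into a product of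
  sums of consecutive variables and of \<open>f\<close>, \<open>g\<close>, \<open>h\<close> under a single substitution each, and the
  substitutions are compared variable by variable. All that enters is the effect of each
  substitution on sums of consecutive variables (\<open>block_subst_block_across\<close>, \<open>push_subst_block_1\<close>
  and their companions).

  The minus sign in the axiom for \<open>\<tau> (f \<circ>\<^sub>1 g)\<close> comes from the prefactor:
  the push in arity \<open>m + n - 1\<close> sends \<open>u\<^sub>1 + \<dots> + u\<^sub>n\<close> to \<open>- (u\<^sub>n + \<dots> + u\<^sub>m\<^sub>+\<^sub>n\<^sub>-\<^sub>1)\<close>. The push in arity
  \<open>n\<close> has order dividing \<open>n + 1\<close> because it permutes cyclically the \<open>n + 1\<close> linear forms
  \<open>- (u\<^sub>1 + \<dots> + u\<^sub>n), u\<^sub>1, \<dots>, u\<^sub>n\<close> (\<open>push_power\<close>).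
\<close>

section \<open>Variables of polynomials\<close>

lemma vars_zero [simp]: "vars 0 = {}" and vars_one [simp]: "vars 1 = {}"
  by (auto simp: vars_def)

lemma vars_add: "vars (p + q) \<subseteq> vars p \<union> vars q"
  using keys_add[of p q] by (auto simp: vars_def)

lemma vars_uminus [simp]: "vars (- p) = vars p"
  by (simp add: vars_def keys_def)

lemma vars_mult: "vars (p * q) \<subseteq> vars p \<union> vars q"
proof
  fix k assume "k \<in> vars (p * q)"
  then obtain m where m: "m \<in> Poly_Mapping.keys (p * q)" "k \<in> Poly_Mapping.keys m"
    by (auto simp: vars_def)
  then obtain a b where "a \<in> Poly_Mapping.keys p" "b \<in> Poly_Mapping.keys q" "m = a + b"
    using keys_mult[of p q] by blast
  with m(2) keys_add[of a b] show "k \<in> vars p \<union> vars q"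
    by (auto simp: vars_def)
qed

section \<open>Rational functions in a given set of variables\<close>

text \<open>The subfield of rational functions that involve only the variables indexed by \<open>A\<close>.\<close>

definition ratfun :: "nat set \<Rightarrow> qrat set" where
  "ratfun A = {Fract p q | p q. q \<noteq> 0 \<and> vars p \<subseteq> A \<and> vars q \<subseteq> A}"

lemma Mould_eq_ratfun: "Mould n = ratfun {1..n}"
  by (simp add: Mould_def ratfun_def)

lemma ratfunI: "q \<noteq> 0 \<Longrightarrow> vars p \<subseteq> A \<Longrightarrow> vars q \<subseteq> A \<Longrightarrow> Fract p q \<in> ratfun A"
  by (auto simp: ratfun_def)

lemma ratfunE:
  assumes "f \<in> ratfun A"
  obtains p q where "f = Fract p q" "q \<noteq> 0" "vars p \<subseteq> A" "vars q \<subseteq> A"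
  using assms by (auto simp: ratfun_def)

lemma ratfun_const [simp]: "const c \<in> ratfun A"
  unfolding const_def by (rule ratfunI) (auto simp: vars_def)

lemma ratfun_zero [simp]: "0 \<in> ratfun A"
  using ratfun_const[of 0 A] by simp

lemma const_1 [simp]: "const 1 = 1"
  by (simp add: const_def One_fract_def)

lemma ratfun_one [simp]: "1 \<in> ratfun A"
  using ratfun_const[of 1 A] by simp

lemma ratfun_u [simp]: "k \<in> A \<Longrightarrow> u k \<in> ratfun A"
  unfolding u_def by (rule ratfunI) (auto simp: vars_def)

lemma ratfun_add [simp]:
  assumes "f \<in> ratfun A" "g \<in> ratfun A"
  shows "f + g \<in> ratfun A"
proof -
  obtain p q where f: "f = Fract p q" "q \<noteq> 0" "vars p \<subseteq> A" "vars q \<subseteq> A"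
    using assms(1) by (rule ratfunE)
  obtain p' q' where g: "g = Fract p' q'" "q' \<noteq> 0" "vars p' \<subseteq> A" "vars q' \<subseteq> A"
    using assms(2) by (rule ratfunE)
  have "vars (p * q' + p' * q) \<subseteq> A" "vars (q * q') \<subseteq> A"
    using vars_add[of "p * q'" "p' * q"] vars_mult[of p q'] vars_mult[of p' q]
      vars_mult[of q q'] f g by blast+
  then show ?thesis
    using f g by (auto intro!: ratfunI)
qed

lemma ratfun_mult [simp]:
  assumes "f \<in> ratfun A" "g \<in> ratfun A"
  shows "f * g \<in> ratfun A"
proof -
  obtain p q where f: "f = Fract p q" "q \<noteq> 0" "vars p \<subseteq> A" "vars q \<subseteq> A"
    using assms(1) by (rule ratfunE)
  obtain p' q' where g: "g = Fract p' q'" "q' \<noteq> 0" "vars p' \<subseteq> A" "vars q' \<subseteq> A"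
    using assms(2) by (rule ratfunE)
  have "vars (p * p') \<subseteq> A" "vars (q * q') \<subseteq> A"
    using vars_mult[of p p'] vars_mult[of q q'] f g by blast+
  then show ?thesis
    using f g by (auto intro!: ratfunI)
qed

lemma ratfun_uminus [simp]: "f \<in> ratfun A \<Longrightarrow> - f \<in> ratfun A"
  by (erule ratfunE) (simp add: ratfunI)

lemma ratfun_inverse [simp]: "f \<in> ratfun A \<Longrightarrow> inverse f \<in> ratfun A"
proof (erule ratfunE)
  fix p q assume *: "f = Fract p q" "q \<noteq> 0" "vars p \<subseteq> A" "vars q \<subseteq> A"
  show "inverse f \<in> ratfun A"
  proof (cases "p = 0")
    case True
    then show ?thesis using * by (simp add: fract_collapse)
  next
    case False
    then show ?thesis using * by (auto intro!: ratfunI)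
  qed
qed

lemma ratfun_divide [simp]: "f \<in> ratfun A \<Longrightarrow> g \<in> ratfun A \<Longrightarrow> f / g \<in> ratfun A"
  by (simp add: divide_inverse)

lemma ratfun_sum: "(\<And>x. x \<in> X \<Longrightarrow> h x \<in> ratfun A) \<Longrightarrow> sum h X \<in> ratfun A"
  by (induction X rule: infinite_finite_induct) auto

lemma ratfun_prod: "(\<And>x. x \<in> X \<Longrightarrow> h x \<in> ratfun A) \<Longrightarrow> prod h X \<in> ratfun A"
  by (induction X rule: infinite_finite_induct) auto

lemma ratfun_power: "f \<in> ratfun A \<Longrightarrow> f ^ e \<in> ratfun A"
  by (induction e) auto

lemma poly_subst_in_ratfun:
  assumes "\<And>k. k \<in> A \<Longrightarrow> s k \<in> ratfun B" "vars p \<subseteq> A"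
  shows "poly_subst s p \<in> ratfun B"
  unfolding poly_subst_def mon_subst_def using assms
  by (intro ratfun_sum ratfun_mult ratfun_prod ratfun_power) (auto simp: vars_def)

section \<open>Polynomial substitution\<close>

lemma mon_subst_zero [simp]: "mon_subst s 0 = 1"
  by (simp add: mon_subst_def)

lemma mon_subst_single [simp]: "mon_subst s (Poly_Mapping.single k e) = s k ^ e"
  by (simp add: mon_subst_def)

lemma poly_subst_one [simp]: "poly_subst s 1 = 1"
  using poly_subst_single[of s 0 1] by simp

lemma poly_subst_uminus: "poly_subst s (- p) = - poly_subst s p"
  using poly_subst_add[of s p "- p"] by (simp add: eq_neg_iff_add_eq_0 add.commute)

lemma poly_subst_cong:
  assumes "\<And>k. k \<in> vars p \<Longrightarrow> s k = t k"
  shows "poly_subst s p = poly_subst t p"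
proof -
  have "mon_subst s m = mon_subst t m" if "m \<in> Poly_Mapping.keys p" for m
    unfolding mon_subst_def using that
    by (intro prod.cong refl arg_cong2[where f = "(^)"] assms) (auto simp: vars_def)
  then show ?thesis by (simp add: poly_subst_def)
qed

lemma u_power: "u k ^ e = Fract (Poly_Mapping.single (Poly_Mapping.single k e) 1) 1"
  by (induction e) (simp_all add: u_def mult_single single_add[symmetric] One_fract_def)

lemma mon_subst_u: "mon_subst u m = Fract (Poly_Mapping.single m 1) 1"
proof (induction m rule: update_induct)
  case const
  show ?case by (simp add: One_fract_def)
next
  case (update m k e)
  have "Poly_Mapping.update k e m = Poly_Mapping.single k e + m"
    using update(1)
    by (intro poly_mapping_eqI)
      (auto simp: lookup_update lookup_add lookup_single when_def in_keys_iff)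
  then show ?case
    using update by (simp add: mon_subst_add u_power mult_single)
qed

text \<open>Substituting each variable for itself embeds polynomials into the fraction field.\<close>

lemma poly_subst_u: "poly_subst u p = Fract p 1"
proof (induction p rule: update_induct)
  case const
  show ?case by (simp add: Zero_fract_def)
next
  case (update p m c)
  then show ?case
    by (simp add: update_eq_single_add poly_subst_add poly_subst_single mon_subst_u
        const_def mult_single)
qed

section \<open>Substitution as a homomorphism\<close>

text \<open>The rational functions at which the substitution \<open>t\<close> is defined: those with a denominator
  that \<open>t\<close> does not send to zero. They form a local subring of the field.\<close>

definition subst_dom :: "(nat \<Rightarrow> qrat) \<Rightarrow> qrat set" where
  "subst_dom t = {Fract p q | p q. poly_subst t q \<noteq> 0}"

lemma subst_domI: "poly_subst t q \<noteq> 0 \<Longrightarrow> Fract p q \<in> subst_dom t"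
  by (auto simp: subst_dom_def)

lemma subst_domE:
  assumes "f \<in> subst_dom t"
  obtains p q where "f = Fract p q" "poly_subst t q \<noteq> 0" "q \<noteq> 0"
proof -
  obtain p q where "f = Fract p q" "poly_subst t q \<noteq> 0"
    using assms by (auto simp: subst_dom_def)
  moreover from this(2) have "q \<noteq> 0" by auto
  ultimately show thesis by (rule that)
qed

lemma subst_dom_const [simp]: "const c \<in> subst_dom t"
  and rat_subst_const [simp]: "rat_subst t (const c) = const c"
proof -
  show "const c \<in> subst_dom t"
    unfolding const_def by (rule subst_domI) simp
  have "rat_subst t (const c) = poly_subst t (Poly_Mapping.single 0 c)"
    unfolding const_def by (subst rat_subst_Fract) simp_all
  then show "rat_subst t (const c) = const c"
    by (simp add: poly_subst_single)
qed

lemma subst_dom_zero [simp]: "0 \<in> subst_dom t" and rat_subst_zero [simp]: "rat_subst t 0 = 0"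
  using subst_dom_const[of 0 t] rat_subst_const[of t 0] by simp_all

lemma subst_dom_one [simp]: "1 \<in> subst_dom t" and rat_subst_one [simp]: "rat_subst t 1 = 1"
  using subst_dom_const[of 1 t] rat_subst_const[of t 1] by simp_all

lemma subst_dom_u [simp]: "u k \<in> subst_dom t"
  and rat_subst_u [simp]: "rat_subst t (u k) = t k"
proof -
  show "u k \<in> subst_dom t"
    unfolding u_def by (rule subst_domI) simp
  show "rat_subst t (u k) = t k"
    unfolding u_def by (subst rat_subst_Fract) (simp_all add: poly_subst_single)
qed

lemma
  assumes "f \<in> subst_dom t" "g \<in> subst_dom t"
  shows subst_dom_add [simp]: "f + g \<in> subst_dom t"
    and rat_subst_add [simp]: "rat_subst t (f + g) = rat_subst t f + rat_subst t g"
    and subst_dom_mult [simp]: "f * g \<in> subst_dom t"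
    and rat_subst_mult [simp]: "rat_subst t (f * g) = rat_subst t f * rat_subst t g"
proof -
  obtain p q where f: "f = Fract p q" "poly_subst t q \<noteq> 0" "q \<noteq> 0"
    using assms(1) by (rule subst_domE)
  obtain p' q' where g: "g = Fract p' q'" "poly_subst t q' \<noteq> 0" "q' \<noteq> 0"
    using assms(2) by (rule subst_domE)
  have nz: "poly_subst t (q * q') \<noteq> 0"
    using f g by (simp add: poly_subst_mult)
  have eqs: "f + g = Fract (p * q' + p' * q) (q * q')" "f * g = Fract (p * p') (q * q')"
    using f g by simp_all
  show "f + g \<in> subst_dom t" "f * g \<in> subst_dom t"
    unfolding eqs using nz by (rule subst_domI)+
  show "rat_subst t (f + g) = rat_subst t f + rat_subst t g"
    unfolding eqs rat_subst_Fract[OF nz] using f g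
    by (simp add: rat_subst_Fract poly_subst_add poly_subst_mult add_frac_eq)
  show "rat_subst t (f * g) = rat_subst t f * rat_subst t g"
    unfolding eqs rat_subst_Fract[OF nz] using f g
    by (simp add: rat_subst_Fract poly_subst_mult)
qed

lemma
  assumes "f \<in> subst_dom t"
  shows subst_dom_uminus [simp]: "- f \<in> subst_dom t"
    and rat_subst_uminus [simp]: "rat_subst t (- f) = - rat_subst t f"
proof -
  obtain p q where f: "f = Fract p q" "poly_subst t q \<noteq> 0" "q \<noteq> 0"
    using assms by (rule subst_domE)
  then show "- f \<in> subst_dom t" "rat_subst t (- f) = - rat_subst t f"
    by (simp_all add: subst_domI rat_subst_Fract poly_subst_uminus)
qed

lemma
  assumes "\<And>x. x \<in> X \<Longrightarrow> h x \<in> subst_dom t"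
  shows subst_dom_sum [simp]: "sum h X \<in> subst_dom t"
    and rat_subst_sum [simp]: "rat_subst t (sum h X) = (\<Sum>x\<in>X. rat_subst t (h x))"
proof -
  have "sum h X \<in> subst_dom t \<and> rat_subst t (sum h X) = (\<Sum>x\<in>X. rat_subst t (h x))"
    using assms by (induction X rule: infinite_finite_induct) auto
  then show "sum h X \<in> subst_dom t" "rat_subst t (sum h X) = (\<Sum>x\<in>X. rat_subst t (h x))"
    by simp_all
qed

lemma
  assumes "\<And>x. x \<in> X \<Longrightarrow> h x \<in> subst_dom t"
  shows subst_dom_prod: "prod h X \<in> subst_dom t"
    and rat_subst_prod: "rat_subst t (prod h X) = (\<Prod>x\<in>X. rat_subst t (h x))"
proof -
  have "prod h X \<in> subst_dom t \<and> rat_subst t (prod h X) = (\<Prod>x\<in>X. rat_subst t (h x))"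
    using assms by (induction X rule: infinite_finite_induct) auto
  then show "prod h X \<in> subst_dom t" "rat_subst t (prod h X) = (\<Prod>x\<in>X. rat_subst t (h x))"
    by simp_all
qed

lemma
  assumes "f \<in> subst_dom t"
  shows subst_dom_power: "f ^ e \<in> subst_dom t"
    and rat_subst_power: "rat_subst t (f ^ e) = rat_subst t f ^ e"
proof -
  have "f ^ e \<in> subst_dom t \<and> rat_subst t (f ^ e) = rat_subst t f ^ e"
    using assms by (induction e) auto
  then show "f ^ e \<in> subst_dom t" "rat_subst t (f ^ e) = rat_subst t f ^ e"
    by simp_all
qed

lemma rat_subst_poly_subst:
  assumes "\<And>k. k \<in> vars p \<Longrightarrow> s k \<in> subst_dom t"
  shows "rat_subst t (poly_subst s p) = poly_subst (\<lambda>k. rat_subst t (s k)) p"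
proof -
  have mon: "mon_subst s m \<in> subst_dom t \<and>
      rat_subst t (mon_subst s m) = mon_subst (\<lambda>k. rat_subst t (s k)) m"
    if "m \<in> Poly_Mapping.keys p" for m
  proof -
    have s: "s k \<in> subst_dom t" if "k \<in> Poly_Mapping.keys m" for k
      using that assms \<open>m \<in> Poly_Mapping.keys p\<close> by (auto simp: vars_def)
    then show ?thesis
      unfolding mon_subst_def
      by (simp add: subst_dom_prod rat_subst_prod subst_dom_power rat_subst_power)
  qed
  then show ?thesis
    by (simp add: poly_subst_def)
qed

section \<open>Algebraically independent substitutions\<close>

text \<open>The values \<open>s k\<close> for \<open>k \<in> A\<close> are algebraically independent; equivalently, \<open>s\<close> is
  injective on the polynomials in the variables indexed by \<open>A\<close>, so that it extends to a field
  embedding of \<^term>\<open>ratfun A\<close>.\<close>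

definition alg_indep :: "nat set \<Rightarrow> (nat \<Rightarrow> qrat) \<Rightarrow> bool" where
  "alg_indep A s \<longleftrightarrow> (\<forall>q. q \<noteq> 0 \<longrightarrow> vars q \<subseteq> A \<longrightarrow> poly_subst s q \<noteq> 0)"

lemma ratfun_subset_subst_dom: "alg_indep A s \<Longrightarrow> f \<in> ratfun A \<Longrightarrow> f \<in> subst_dom s"
  by (auto simp: alg_indep_def elim!: ratfunE intro!: subst_domI)

lemma rat_subst_nonzero:
  assumes "alg_indep A s" "f \<in> ratfun A" "f \<noteq> 0"
  shows "rat_subst s f \<noteq> 0"
proof -
  obtain p q where f: "f = Fract p q" "q \<noteq> 0" "vars p \<subseteq> A" "vars q \<subseteq> A"
    using assms(2) by (rule ratfunE)
  then have "p \<noteq> 0" using assms(3) by (auto simp: fract_collapse)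
  then have "poly_subst s p \<noteq> 0" "poly_subst s q \<noteq> 0"
    using assms(1) f by (auto simp: alg_indep_def)
  then show ?thesis using f by (simp add: rat_subst_Fract)
qed

lemma rat_subst_cong:
  assumes "f \<in> ratfun A" "alg_indep A s" "\<And>k. k \<in> A \<Longrightarrow> s k = t k"
  shows "rat_subst s f = rat_subst t f"
proof -
  obtain p q where f: "f = Fract p q" "q \<noteq> 0" "vars p \<subseteq> A" "vars q \<subseteq> A"
    using assms(1) by (rule ratfunE)
  have "poly_subst s p = poly_subst t p" "poly_subst s q = poly_subst t q"
    using f assms(3) by (auto intro!: poly_subst_cong)
  moreover have "poly_subst s q \<noteq> 0"
    using assms(2) f by (auto simp: alg_indep_def)
  ultimately show ?thesis using f by (simp add: rat_subst_Fract)
qed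

lemma rat_subst_in_ratfun:
  assumes "f \<in> ratfun A" "alg_indep A s" "\<And>k. k \<in> A \<Longrightarrow> s k \<in> ratfun B"
  shows "rat_subst s f \<in> ratfun B"
proof -
  obtain p q where f: "f = Fract p q" "q \<noteq> 0" "vars p \<subseteq> A" "vars q \<subseteq> A"
    using assms(1) by (rule ratfunE)
  have "poly_subst s q \<noteq> 0"
    using assms(2) f by (auto simp: alg_indep_def)
  moreover have "poly_subst s p \<in> ratfun B" "poly_subst s q \<in> ratfun B"
    using f assms(3) poly_subst_in_ratfun by metis+
  ultimately show ?thesis using f by (simp add: rat_subst_Fract)
qed

lemma rat_subst_identity:
  assumes "f \<in> ratfun A" "\<And>k. k \<in> A \<Longrightarrow> s k = u k"
  shows "rat_subst s f = f"
proof -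
  obtain p q where f: "f = Fract p q" "q \<noteq> 0" "vars p \<subseteq> A" "vars q \<subseteq> A"
    using assms(1) by (rule ratfunE)
  have "poly_subst s p = Fract p 1" "poly_subst s q = Fract q 1"
    using f assms(2) unfolding poly_subst_u[symmetric] by (auto intro!: poly_subst_cong)
  with f show ?thesis
    by (simp add: rat_subst_Fract Zero_fract_def eq_fract)
qed

lemma alg_indep_comp:
  assumes "alg_indep A s" "alg_indep B t" "\<And>k. k \<in> A \<Longrightarrow> s k \<in> ratfun B"
  shows "alg_indep A (\<lambda>k. rat_subst t (s k))"
  unfolding alg_indep_def
proof (intro allI impI)
  fix q :: qpoly assume q: "q \<noteq> 0" "vars q \<subseteq> A"
  have "rat_subst t (poly_subst s q) = poly_subst (\<lambda>k. rat_subst t (s k)) q"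
    using q assms by (intro rat_subst_poly_subst ratfun_subset_subst_dom) auto
  moreover have "poly_subst s q \<noteq> 0" using assms(1) q by (auto simp: alg_indep_def)
  moreover have "poly_subst s q \<in> ratfun B" using assms(3) q(2) by (rule poly_subst_in_ratfun)
  ultimately show "poly_subst (\<lambda>k. rat_subst t (s k)) q \<noteq> 0"
    using rat_subst_nonzero[OF assms(2)] by metis
qed

text \<open>The composite substitution is given as a separate \<open>r\<close>, required to agree with
  \<open>\<lambda>k. rat_subst t (s k)\<close> on \<open>A\<close> only: outside \<open>A\<close> the values of \<open>s\<close> are irrelevant to \<open>f\<close>, and
  \<open>t\<close> need not be defined there.\<close>

lemma rat_subst_comp:
  assumes "f \<in> ratfun A" "alg_indep A s" "alg_indep B t"
    and "\<And>k. k \<in> A \<Longrightarrow> s k \<in> ratfun B" "\<And>k. k \<in> A \<Longrightarrow> rat_subst t (s k) = r k"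
  shows "rat_subst t (rat_subst s f) = rat_subst r f"
proof -
  let ?ts = "\<lambda>k. rat_subst t (s k)"
  obtain p q where f: "f = Fract p q" "q \<noteq> 0" "vars p \<subseteq> A" "vars q \<subseteq> A"
    using assms(1) by (rule ratfunE)
  have eq: "rat_subst t (poly_subst s p') = poly_subst ?ts p'"
    and mem: "poly_subst s p' \<in> subst_dom t" if "vars p' \<subseteq> A" for p'
    using that assms(3,4)
    by (blast intro: rat_subst_poly_subst ratfun_subset_subst_dom poly_subst_in_ratfun)+
  have s: "poly_subst s q \<noteq> 0" using assms(2) f by (auto simp: alg_indep_def)
  have ts: "poly_subst ?ts q \<noteq> 0"
    using alg_indep_comp[OF assms(2-4)] f by (auto simp: alg_indep_def)
  have sf: "rat_subst s f = poly_subst s p / poly_subst s q"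
    using f s by (simp add: rat_subst_Fract)
  have "rat_subst s f \<in> subst_dom t"
    using rat_subst_in_ratfun[OF assms(1,2,4)] assms(3) by (metis ratfun_subset_subst_dom)
  then have "rat_subst t (rat_subst s f) * rat_subst t (poly_subst s q)
      = rat_subst t (rat_subst s f * poly_subst s q)"
    using mem f by simp
  also have "rat_subst s f * poly_subst s q = poly_subst s p" using sf s by simp
  finally have "rat_subst t (rat_subst s f) = rat_subst ?ts f"
    using ts f by (simp add: eq rat_subst_Fract eq_divide_eq)
  also have "\<dots> = rat_subst r f"
    using assms(1) alg_indep_comp[OF assms(2-4)] assms(5) by (rule rat_subst_cong)
  finally show ?thesis .
qed

text \<open>A substitution with a left inverse is algebraically independent. The left inverse need not be
  algebraically independent itself; it may send variables to zero.\<close>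

lemma alg_indep_left_inverse:
  assumes "\<And>k. k \<in> A \<Longrightarrow> s k \<in> subst_dom t" "\<And>k. k \<in> A \<Longrightarrow> rat_subst t (s k) = u k"
  shows "alg_indep A s"
  unfolding alg_indep_def
proof (intro allI impI notI)
  fix q :: qpoly assume q: "q \<noteq> 0" "vars q \<subseteq> A" "poly_subst s q = 0"
  have "0 = rat_subst t (poly_subst s q)" using q by simp
  also have "\<dots> = poly_subst (\<lambda>k. rat_subst t (s k)) q"
    using q assms by (intro rat_subst_poly_subst) auto
  also have "\<dots> = poly_subst u q" using q assms by (intro poly_subst_cong) auto
  also have "\<dots> = Fract q 1" by (rule poly_subst_u)
  finally show False using q by (simp add: Zero_fract_def eq_fract)
qed

section \<open>The substitutions defining composition and push\<close>

text \<open>The sum \<open>u a + \<dots> + u b\<close> of consecutive variables, zero if \<open>b < a\<close>.\<close>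

definition block :: "nat \<Rightarrow> nat \<Rightarrow> qrat" where
  "block a b = (\<Sum>l=a..b. u l)"

text \<open>The substitution into the first factor \<open>f\<close> of \<open>mould_circ m n i f g\<close>: the variable \<open>u i\<close>
  becomes a block of length \<open>n\<close>, and the later variables move up by \<open>n - 1\<close>.\<close>

definition block_subst :: "nat \<Rightarrow> nat \<Rightarrow> nat \<Rightarrow> qrat" where
  "block_subst i n k =
    (if k < i then u k else if k = i then block i (i + n - 1) else u (k + n - 1))"

text \<open>The substitution into the second factor \<open>g\<close> of \<open>mould_circ m n i f g\<close>.\<close>

definition shift_subst :: "nat \<Rightarrow> nat \<Rightarrow> qrat" where
  "shift_subst i k = u (i + k - 1)"

text \<open>The substitution of the push in arity \<open>n\<close>; it sends \<open>u 1\<close> to minus the sum of all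
  variables.\<close>

definition push_subst :: "nat \<Rightarrow> nat \<Rightarrow> qrat" where
  "push_subst n k = (if k = 1 then - block 1 n else u (k - 1))"

lemma mould_circ_eq:
  "mould_circ m n i f g =
    block i (i + n - 1) * rat_subst (block_subst i n) f * rat_subst (shift_subst i) g"
  unfolding mould_circ_def block_def block_subst_def shift_subst_def ..

lemma push_eq: "push n = rat_subst (push_subst n)"
  unfolding push_def block_def push_subst_def ..

lemma ratfun_block [simp]: "a' \<le> a \<Longrightarrow> b \<le> b' \<Longrightarrow> block a b \<in> ratfun {a'..b'}"
  unfolding block_def by (intro ratfun_sum) auto

lemma subst_dom_block [simp]: "block a b \<in> subst_dom t"
  by (simp add: block_def)

lemma rat_subst_block: "rat_subst t (block a b) = (\<Sum>l=a..b. t l)"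
  by (simp add: block_def)

lemma block_split: "a \<le> Suc b \<Longrightarrow> b \<le> c \<Longrightarrow> block a c = block a b + block (Suc b) c"
  unfolding block_def using sum.ub_add_nat[of a b u "c - b"] by simp

lemma block_single [simp]: "block a a = u a"
  by (simp add: block_def)

lemma sum_u_shift: "(\<Sum>l=a..b. u (l + c)) = block (a + c) (b + c)"
  unfolding block_def by (rule sum.shift_bounds_cl_nat_ivl[symmetric])

lemma block_subst_block_below:
  assumes "b < i"
  shows "rat_subst (block_subst i n) (block a b) = block a b"
  unfolding rat_subst_block unfolding block_def
  using assms by (intro sum.cong) (auto simp: block_subst_def)

lemma block_subst_block_above:
  assumes "i < a" "1 \<le> n"
  shows "rat_subst (block_subst i n) (block a b) = block (a + n - 1) (b + n - 1)"
proof -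
  have "(\<Sum>l=a..b. block_subst i n l) = (\<Sum>l=a..b. u (l + (n - 1)))"
    using assms by (intro sum.cong) (auto simp: block_subst_def)
  also have "\<dots> = block (a + (n - 1)) (b + (n - 1))" by (rule sum_u_shift)
  finally show ?thesis using assms by (simp add: rat_subst_block)
qed

lemma block_subst_block_across:
  assumes "1 \<le> n" "a \<le> i" "i \<le> b"
  shows "rat_subst (block_subst i n) (block a b) = block a (b + n - 1)"
proof -
  let ?s = "rat_subst (block_subst i n)"
  obtain n' where n: "n = Suc n'" using assms by (cases n) auto
  have "?s (block a i) = block a (i + n')"
  proof (cases i)
    case 0
    then show ?thesis using assms by (simp add: block_subst_def n)
  next
    case (Suc i')
    have "block a i = block a i' + u i"
      using assms block_split[of a i' i] by (simp add: Suc)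
    then show ?thesis
      using assms block_split[of a i' "i + n'"]
      by (simp add: Suc block_subst_block_below block_subst_def n)
  qed
  moreover have "block a b = block a i + block (Suc i) b"
    using assms by (intro block_split) auto
  ultimately show ?thesis
    using assms block_split[of a "i + n'" "b + n'"] by (simp add: block_subst_block_above n)
qed

lemma shift_subst_block:
  assumes "1 \<le> i"
  shows "rat_subst (shift_subst i) (block a b) = block (i + a - 1) (i + b - 1)"
proof -
  have "(\<Sum>l=a..b. shift_subst i l) = (\<Sum>l=a..b. u (l + (i - 1)))"
    using assms by (intro sum.cong) (auto simp: shift_subst_def add.commute)
  also have "\<dots> = block (a + (i - 1)) (b + (i - 1))" by (rule sum_u_shift)
  finally show ?thesis using assms by (simp add: rat_subst_block add.commute)
qed

lemma push_subst_block:
  assumes "2 \<le> a" "a \<le> b"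
  shows "rat_subst (push_subst n) (block a b) = block (a - 1) (b - 1)"
proof -
  obtain a' b' where ab: "a = Suc a'" "b = Suc b'" "1 \<le> a'"
    using assms by (cases a; cases b) auto
  have "(\<Sum>l=a..b. push_subst n l) = (\<Sum>l=a'..b'. push_subst n (Suc l))"
    unfolding ab by (rule sum.shift_bounds_cl_Suc_ivl)
  also have "\<dots> = block a' b'"
    unfolding block_def using ab by (intro sum.cong) (auto simp: push_subst_def)
  finally show ?thesis using ab by (simp add: rat_subst_block)
qed

lemma push_subst_block_1:
  assumes "1 \<le> b" "b \<le> n"
  shows "rat_subst (push_subst n) (block 1 b) = - block b n"
proof (cases "b = 1")
  case True
  then show ?thesis by (simp add: push_subst_def)
next
  case False
  then have "2 \<le> b" using assms by simp
  then have "rat_subst (push_subst n) (block 1 b) = - block 1 n + block 1 (b - 1)"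
    using block_split[of 1 1 b] by (simp add: push_subst_block[of 2, simplified] push_subst_def
      numeral_2_eq_2[symmetric])
  also have "\<dots> = - block b n"
    using assms block_split[of 1 "b - 1" n] by simp
  finally show ?thesis .
qed

lemma alg_indep_block_subst:
  assumes "1 \<le> n"
  shows "alg_indep A (block_subst i n)"
proof -
  \<comment> \<open>The left inverse keeps \<open>u i\<close> from the inserted block and kills the rest of the block.\<close>
  define t where "t k = (if k \<le> i then u k else if k < i + n then 0 else u (k + 1 - n))" for k
  have "block_subst i n k \<in> subst_dom t" for k
    by (simp add: block_subst_def)
  moreover have "rat_subst t (block_subst i n k) = u k" for k
  proof (cases "k = i")
    case True
    have "(\<Sum>l=i..i + n - 1. t l) = t i + (\<Sum>l=Suc i..i + n - 1. t l)"
      using assms by (intro sum.atLeast_Suc_atMost) simp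
    also have "(\<Sum>l=Suc i..i + n - 1. t l) = 0"
      using assms by (intro sum.neutral) (auto simp: t_def)
    finally show ?thesis using True by (simp add: block_subst_def rat_subst_block t_def)
  next
    case False
    then show ?thesis using assms by (auto simp: block_subst_def t_def)
  qed
  ultimately show ?thesis by (rule alg_indep_left_inverse)
qed

lemma alg_indep_shift_subst:
  assumes "1 \<le> i"
  shows "alg_indep A (shift_subst i)"
  by (rule alg_indep_left_inverse[where t = "\<lambda>k. u (k + 1 - i)"])
    (use assms in \<open>simp_all add: shift_subst_def\<close>)

lemma alg_indep_push_subst:
  assumes "1 \<le> n"
  shows "alg_indep {1..n} (push_subst n)"
proof -
  \<comment> \<open>The inverse push, which sends \<open>u n\<close> to minus the sum of all variables.\<close>
  define t where "t k = (if k = n then - block 1 n else u (k + 1))" for k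
  have "push_subst n k \<in> subst_dom t" for k
    by (simp add: push_subst_def)
  moreover have "rat_subst t (push_subst n k) = u k" if k: "k \<in> {1..n}" for k
  proof (cases "k = 1")
    case True
    obtain n' where n: "n = Suc n'" using assms by (cases n) auto
    have "(\<Sum>l=1..n. t l) = (\<Sum>l=1..n'. t l) + t n"
      by (simp add: n)
    also have "(\<Sum>l=1..n'. t l) = (\<Sum>l=1..n'. u (l + 1))"
      by (intro sum.cong) (auto simp: t_def n)
    also have "\<dots> = block 2 n" by (simp only: sum_u_shift) (simp add: n numeral_2_eq_2)
    also have "t n = - (u 1 + block 2 n)"
      using block_split[of 1 1 n] assms by (simp add: t_def numeral_2_eq_2)
    finally show ?thesis using True by (simp add: push_subst_def rat_subst_block)
  next
    case False
    then show ?thesis using k by (auto simp: push_subst_def t_def)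
  qed
  ultimately show ?thesis by (rule alg_indep_left_inverse)
qed

lemma block_subst_in_ratfun:
  "\<lbrakk>1 \<le> i; i \<le> m; 1 \<le> n; k \<in> {1..m}\<rbrakk> \<Longrightarrow> block_subst i n k \<in> ratfun {1..m + n - 1}"
  by (auto simp: block_subst_def intro!: ratfun_block ratfun_u)

lemma shift_subst_in_ratfun:
  "\<lbrakk>1 \<le> i; i \<le> m; k \<in> {1..n}\<rbrakk> \<Longrightarrow> shift_subst i k \<in> ratfun {1..m + n - 1}"
  by (auto simp: shift_subst_def intro!: ratfun_u)

lemma push_subst_in_ratfun: "k \<in> {1..n} \<Longrightarrow> push_subst n k \<in> ratfun {1..n}"
  by (auto simp: push_subst_def intro!: ratfun_u)

section \<open>Moulds as an anticyclic operad\<close>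

context
  fixes i m n :: nat and f g :: qrat
  assumes i: "1 \<le> i" "i \<le> m" and n: "1 \<le> n" and f: "f \<in> Mould m" and g: "g \<in> Mould n"
begin

lemma rat_subst_block_subst_in: "rat_subst (block_subst i n) f \<in> ratfun {1..m + n - 1}"
  using f[unfolded Mould_eq_ratfun] alg_indep_block_subst[OF n] block_subst_in_ratfun[OF i n]
  by (rule rat_subst_in_ratfun)

lemma rat_subst_shift_subst_in: "rat_subst (shift_subst i) g \<in> ratfun {1..m + n - 1}"
  using g[unfolded Mould_eq_ratfun] alg_indep_shift_subst[OF i(1)] shift_subst_in_ratfun[OF i]
  by (rule rat_subst_in_ratfun)

lemma mould_circ_in_Mould: "mould_circ m n i f g \<in> Mould (m + n - 1)"
proof -
  have "i + n - 1 \<le> m + n - 1" using i by auto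
  then show ?thesis
    unfolding mould_circ_eq Mould_eq_ratfun using i
    by (intro ratfun_mult ratfun_block rat_subst_block_subst_in rat_subst_shift_subst_in)
qed

text \<open>An outer substitution \<open>t\<close> passes through a composition. In the applications \<open>r\<close> and \<open>r'\<close> are
  explicit descriptions of the composite substitutions, by cases on the index.\<close>

lemma rat_subst_mould_circ:
  assumes t: "alg_indep {1..m + n - 1} t"
    and x: "rat_subst t (block i (i + n - 1)) = x"
    and r: "\<And>k. k \<in> {1..m} \<Longrightarrow> rat_subst t (block_subst i n k) = r k"
    and r': "\<And>k. k \<in> {1..n} \<Longrightarrow> rat_subst t (shift_subst i k) = r' k"
  shows "rat_subst t (mould_circ m n i f g) = x * rat_subst r f * rat_subst r' g"
proof -
  have "rat_subst t (mould_circ m n i f g) = rat_subst t (block i (i + n - 1))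
      * rat_subst t (rat_subst (block_subst i n) f) * rat_subst t (rat_subst (shift_subst i) g)"
    unfolding mould_circ_eq
    using ratfun_subset_subst_dom[OF t rat_subst_block_subst_in]
      ratfun_subset_subst_dom[OF t rat_subst_shift_subst_in]
    by simp
  moreover have "rat_subst t (rat_subst (block_subst i n) f) = rat_subst r f"
    using f[unfolded Mould_eq_ratfun] alg_indep_block_subst[OF n] t
      block_subst_in_ratfun[OF i n] r by (rule rat_subst_comp)
  moreover have "rat_subst t (rat_subst (shift_subst i) g) = rat_subst r' g"
    using g[unfolded Mould_eq_ratfun] alg_indep_shift_subst[OF i(1)] t
      shift_subst_in_ratfun[OF i] r' by (rule rat_subst_comp)
  ultimately show ?thesis by (simp only: x)
qed

end

lemmas block_simps = block_subst_block_below block_subst_block_above block_subst_block_across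
  shift_subst_block push_subst_block push_subst_block_1 push_subst_block_1[simplified]

lemma mould_circ_parallel:
  assumes ij: "1 \<le> i" "i < j" "j \<le> m" and n: "1 \<le> n" and p: "1 \<le> p"
    and f: "f \<in> Mould m" and g: "g \<in> Mould n" and h: "h \<in> Mould p"
  shows "mould_circ (m + n - 1) p (j + n - 1) (mould_circ m n i f g) h
    = mould_circ (m + p - 1) n i (mould_circ m p j f h) g"
proof -
  \<comment> \<open>The substitution into \<open>f\<close> on both sides: two disjoint blocks are inserted.\<close>
  define r where "r k = (if k < i then u k else if k = i then block i (i + n - 1)
    else if k < j then u (k + n - 1) else if k = j then block (j + n - 1) (j + n + p - 2)
    else u (k + n + p - 2))" for k
  obtain n' p' where np: "n = Suc n'" "p = Suc p'"
    using n p by (cases n; cases p) auto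
  have "rat_subst (block_subst (j + n - 1) p) (mould_circ m n i f g)
      = block i (i + n - 1) * rat_subst r f * rat_subst (shift_subst i) g"
    using ij n p f g
    by (intro rat_subst_mould_circ alg_indep_block_subst)
      (auto simp: np block_subst_def block_simps r_def shift_subst_def)
  moreover have "rat_subst (block_subst i n) (mould_circ m p j f h)
      = block (j + n - 1) (j + n + p - 2) * rat_subst r f * rat_subst (shift_subst (j + n - 1)) h"
    using ij n p f h
    by (intro rat_subst_mould_circ alg_indep_block_subst)
      (auto simp: np block_subst_def block_simps r_def shift_subst_def add_ac)
  ultimately show ?thesis
    unfolding mould_circ_eq[of _ _ _ "mould_circ m n i f g"]
      mould_circ_eq[of _ _ _ "mould_circ m p j f h"]
    by (simp add: np add_ac mult_ac)
qed

lemma mould_circ_nested: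
  assumes ij: "1 \<le> i" "i \<le> m" "1 \<le> j" "j \<le> n" and p: "1 \<le> p"
    and f: "f \<in> Mould m" and g: "g \<in> Mould n" and h: "h \<in> Mould p"
  shows "mould_circ m (n + p - 1) i f (mould_circ n p j g h)
    = mould_circ (m + n - 1) p (j + i - 1) (mould_circ m n i f g) h"
proof -
  \<comment> \<open>The substitution into \<open>g\<close> on both sides. On the right, the inner block of length \<open>p\<close> lies
    inside the block of length \<open>n\<close> and widens it to length \<open>n + p - 1\<close>, as on the left.\<close>
  define r where "r k = (if k < j then u (i + k - 1)
    else if k = j then block (i + j - 1) (i + j + p - 2) else u (i + k + p - 2))" for k
  obtain n' p' i' where np: "n = Suc n'" "p = Suc p'" "i = Suc i'"
    using ij p by (cases n; cases p; cases i) auto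
  have "rat_subst (shift_subst i) (mould_circ n p j g h)
      = block (j + i - 1) (i + j + p - 2) * rat_subst r g * rat_subst (shift_subst (j + i - 1)) h"
    using ij p g h
    by (intro rat_subst_mould_circ alg_indep_shift_subst)
      (auto simp: np block_subst_def block_simps r_def shift_subst_def add_ac)
  moreover have "rat_subst (block_subst (j + i - 1) p) (mould_circ m n i f g)
      = block i (i + n + p - 2) * rat_subst (block_subst i (n + p - 1)) f * rat_subst r g"
    using ij p f g
    by (intro rat_subst_mould_circ alg_indep_block_subst)
      (auto simp: np block_subst_def block_simps r_def shift_subst_def add_ac)
  ultimately show ?thesis
    unfolding mould_circ_eq[of _ _ _ _ "mould_circ n p j g h"]
      mould_circ_eq[of _ _ _ "mould_circ m n i f g"]
    by (simp add: np add_ac mult_ac)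
qed

lemma push_in_Mould: "1 \<le> n \<Longrightarrow> f \<in> Mould n \<Longrightarrow> push n f \<in> Mould n"
  unfolding push_eq Mould_eq_ratfun
  using alg_indep_push_subst push_subst_in_ratfun by (blast intro: rat_subst_in_ratfun)

lemma push_mould_circ:
  assumes i: "2 \<le> i" "i \<le> m" and n: "1 \<le> n" and f: "f \<in> Mould m" and g: "g \<in> Mould n"
  shows "push (m + n - 1) (mould_circ m n i f g) = mould_circ m n (i - 1) (push m f) g"
proof -
  \<comment> \<open>The substitution into \<open>f\<close> on both sides.\<close>
  define r where "r k = (if k = 1 then - block 1 (m + n - 1) else if k < i then u (k - 1)
    else if k = i then block (i - 1) (i + n - 2) else u (k + n - 2))" for k
  obtain n' i' where np: "n = Suc n'" "i = Suc i'" "1 \<le> i'"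
    using i n by (cases n; cases i) auto
  have "push (m + n - 1) (mould_circ m n i f g)
      = block (i - 1) (i + n - 2) * rat_subst r f * rat_subst (shift_subst (i - 1)) g"
    unfolding push_eq using i n f g
    by (intro rat_subst_mould_circ alg_indep_push_subst)
      (auto simp: np block_subst_def block_simps r_def shift_subst_def push_subst_def)
  moreover have "rat_subst (block_subst (i - 1) n) (push m f) = rat_subst r f"
    unfolding push_eq using f i n
    by (intro rat_subst_comp[where A = "{1..m}" and B = "{1..m}"]
        alg_indep_push_subst alg_indep_block_subst push_subst_in_ratfun)
      (auto simp: np Mould_eq_ratfun block_subst_def block_simps r_def push_subst_def)
  ultimately show ?thesis
    unfolding mould_circ_eq[of _ _ _ "push m f"]
    by (simp add: np)
qed

lemma push_mould_circ_1:
  assumes m: "1 \<le> m" and n: "1 \<le> n" and f: "f \<in> Mould m" and g: "g \<in> Mould n"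
  shows "push (m + n - 1) (mould_circ m n 1 f g) = - mould_circ n m n (push n g) (push m f)"
proof -
  \<comment> \<open>The substitutions into \<open>f\<close> and into \<open>g\<close> on both sides.\<close>
  define r where "r k = (if k = 1 then - block n (m + n - 1) else u (k + n - 2))" for k
  define r' where "r' k = (if k = 1 then - block 1 (m + n - 1) else u (k - 1))" for k
  obtain m' n' where np: "m = Suc m'" "n = Suc n'"
    using m n by (cases m; cases n) auto
  have "push (m + n - 1) (mould_circ m n 1 f g)
      = - block n (m + n - 1) * rat_subst r f * rat_subst r' g"
    unfolding push_eq using m n f g
    by (intro rat_subst_mould_circ alg_indep_push_subst)
      (auto simp: np block_subst_def block_simps r_def r'_def
        shift_subst_def push_subst_def)
  moreover have "rat_subst (block_subst n m) (push n g) = rat_subst r' g"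
    unfolding push_eq using g m n
    by (intro rat_subst_comp[where A = "{1..n}" and B = "{1..n}"]
        alg_indep_push_subst alg_indep_block_subst push_subst_in_ratfun)
      (auto simp: np Mould_eq_ratfun block_subst_def block_simps r'_def push_subst_def add_ac)
  moreover have "rat_subst (shift_subst n) (push m f) = rat_subst r f"
    unfolding push_eq using f m n
    by (intro rat_subst_comp[where A = "{1..m}" and B = "{1..m}"]
        alg_indep_push_subst alg_indep_shift_subst push_subst_in_ratfun)
      (auto simp: np Mould_eq_ratfun shift_subst_def block_simps r_def push_subst_def add_ac)
  ultimately show ?thesis
    unfolding mould_circ_eq[of _ _ _ "push n g"]
    by (simp add: np add_ac mult_ac)
qed

lemma push_power:
  assumes n: "1 \<le> n" and f: "f \<in> Mould n"
  shows "(push n ^^ (n + 1)) f = f"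
proof -
  \<comment> \<open>The \<open>n + 1\<close> linear forms permuted by the push, indexed modulo \<open>n + 1\<close>.\<close>
  define v where "v k = (if k mod (n + 1) = 0 then - block 1 n else u (k mod (n + 1)))" for k
  have v_in: "v k \<in> ratfun {1..n}" for k
  proof -
    have "k mod (n + 1) < n + 1" by simp
    then show ?thesis by (auto simp: v_def simp del: mod_less_divisor)
  qed
  have push_v: "rat_subst (push_subst n) (v k) = v (k + n)" for k
  proof -
    have mod: "(k + n) mod (n + 1) = (k mod (n + 1) + n) mod (n + 1)"
      by (simp add: mod_add_left_eq)
    consider "k mod (n + 1) = 0" | "k mod (n + 1) = 1" | "2 \<le> k mod (n + 1)" by linarith
    then show ?thesis
    proof cases
      case 1
      then have "(k + n) mod (n + 1) = n" by (simp only: mod) simp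
      then show ?thesis
        using 1 n by (simp add: v_def push_subst_block_1[of n n, simplified])
    next
      case 2
      then have "(k + n) mod (n + 1) = 0" by (simp only: mod) simp
      then show ?thesis using 2 by (simp add: v_def push_subst_def)
    next
      case 3
      then have "k mod (n + 1) + n = k mod (n + 1) - 1 + (n + 1)" by simp
      moreover have "k mod (n + 1) - 1 < n + 1"
        by (rule le_less_trans[OF diff_le_self]) simp
      ultimately have "(k + n) mod (n + 1) = k mod (n + 1) - 1"
        unfolding mod by (metis mod_add_self2 mod_less)
      then show ?thesis using 3 by (simp add: v_def push_subst_def)
    qed
  qed
  \<comment> \<open>Modulo \<open>n + 1\<close>, adding \<open>n\<close> to the index is the same as subtracting \<open>1\<close>.\<close>
  have "(push n ^^ j) f = rat_subst (\<lambda>k. v (k + j * n)) f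
      \<and> alg_indep {1..n} (\<lambda>k. v (k + j * n))" for j
  proof (induction j)
    case 0
    have v: "v k = u k" if "k \<in> {1..n}" for k
      using that by (auto simp: v_def)
    then have "alg_indep {1..n} v"
      by (intro alg_indep_left_inverse[where t = u]) auto
    moreover have "rat_subst v f = f"
      using f[unfolded Mould_eq_ratfun] v by (rule rat_subst_identity)
    ultimately show ?case by simp
  next
    case (Suc j)
    have "rat_subst (push_subst n) (rat_subst (\<lambda>k. v (k + j * n)) f)
        = rat_subst (\<lambda>k. v (k + Suc j * n)) f"
      using f Suc n v_in
      by (intro rat_subst_comp[where A = "{1..n}" and B = "{1..n}"] alg_indep_push_subst)
        (auto simp: Mould_eq_ratfun push_v add_ac)
    moreover have "alg_indep {1..n} (\<lambda>k. v (k + Suc j * n))"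
      using alg_indep_comp[OF conjunct2[OF Suc] alg_indep_push_subst[OF n]] v_in
      by (simp add: push_v add_ac)
    ultimately show ?case using Suc by (simp add: push_eq)
  qed
  then have "(push n ^^ (n + 1)) f = rat_subst (\<lambda>k. v (k + (n + 1) * n)) f" by blast
  also have "\<dots> = f"
    using f[unfolded Mould_eq_ratfun]
  proof (rule rat_subst_identity)
    fix k assume "k \<in> {1..n}"
    then show "v (k + (n + 1) * n) = u k"
      by (simp add: v_def del: mult_Suc)
  qed
  finally show ?thesis .
qed

lemma u_nonzero [simp]: "u k \<noteq> 0"
proof
  assume "u k = 0"
  then have "rat_subst (\<lambda>_. 1) (u k) = rat_subst (\<lambda>_. 1) 0" by simp
  then show False by simp
qed

lemma rat_subst_mould_unit:
  assumes "alg_indep {1} t"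
  shows "t 1 * rat_subst t mould_unit = 1" "rat_subst t mould_unit = 1 / t 1"
proof -
  have "mould_unit \<in> ratfun {1}" by (simp add: mould_unit_def)
  then have "rat_subst t (u 1) * rat_subst t mould_unit = rat_subst t (u 1 * mould_unit)"
    using ratfun_subset_subst_dom[OF assms] by simp
  then show "t 1 * rat_subst t mould_unit = 1" by (simp add: mould_unit_def)
  then show "rat_subst t mould_unit = 1 / t 1" by (auto simp: eq_divide_eq mult.commute)
qed

lemma mould_circ_unit_left:
  assumes "1 \<le> n" "f \<in> Mould n"
  shows "mould_circ 1 n 1 mould_unit f = f"
proof -
  have "rat_subst (shift_subst 1) f = f"
    using assms by (intro rat_subst_identity[where A = "{1..n}"])
      (auto simp: Mould_eq_ratfun shift_subst_def)
  moreover have "block 1 n * rat_subst (block_subst 1 n) mould_unit = 1"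
    using rat_subst_mould_unit(1)[OF alg_indep_block_subst[OF assms(1)], of 1]
    by (simp add: block_subst_def)
  ultimately show ?thesis by (simp add: mould_circ_eq)
qed

lemma mould_circ_unit_right:
  assumes "1 \<le> i" "f \<in> Mould m"
  shows "mould_circ m 1 i f mould_unit = f"
proof -
  have "rat_subst (block_subst i 1) f = f"
    using assms by (intro rat_subst_identity[where A = "{1..m}"])
      (auto simp: Mould_eq_ratfun block_subst_def)
  moreover have "u i * rat_subst (shift_subst i) mould_unit = 1"
    using rat_subst_mould_unit(1)[OF alg_indep_shift_subst[OF assms(1)]]
    by (simp add: shift_subst_def)
  ultimately show ?thesis by (simp add: mould_circ_eq)
qed

lemma vector_space_mould_scale: "vector_space mould_scale"
  by unfold_locales (simp_all add: mould_scale_def const_add const_mult algebra_simps)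

theorem theorem2p1:
  shows "anticyclic_ns_operad mould_scale Mould mould_unit mould_circ push"
proof -
  interpret vector_space mould_scale by (rule vector_space_mould_scale)
  have block: "f \<in> subst_dom (block_subst i n)" if "1 \<le> n" "f \<in> Mould m" for f i n m
    using that ratfun_subset_subst_dom[OF alg_indep_block_subst] by (simp add: Mould_eq_ratfun)
  have shift: "f \<in> subst_dom (shift_subst i)" if "1 \<le> i" "f \<in> Mould m" for f i m
    using that ratfun_subset_subst_dom[OF alg_indep_shift_subst] by (simp add: Mould_eq_ratfun)
  have push: "f \<in> subst_dom (push_subst n)" if "1 \<le> n" "f \<in> Mould n" for f n
    using that ratfun_subset_subst_dom[OF alg_indep_push_subst] by (simp add: Mould_eq_ratfun)
  show ?thesis
  proof unfold_locales
    show "subspace (Mould n)" for n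
      by (rule subspaceI) (simp_all add: Mould_eq_ratfun mould_scale_def)
    show "mould_unit \<in> Mould 1"
      by (simp add: Mould_eq_ratfun mould_unit_def)
    show "push 1 mould_unit = - mould_unit"
      using rat_subst_mould_unit(2)[of "push_subst 1"] alg_indep_push_subst[of 1]
      by (simp add: push_eq push_subst_def mould_unit_def)
    \<comment> \<open>Apart from the axioms already proved, only linearity of composition and push remains; it
      holds because substitution is a homomorphism where it is defined.\<close>
  qed ((rule mould_circ_in_Mould mould_circ_unit_left mould_circ_unit_right mould_circ_parallel
        mould_circ_nested push_in_Mould push_power push_mould_circ push_mould_circ_1; assumption)
      | (simp add: mould_circ_eq push_eq mould_scale_def block shift push; simp add: algebra_simps))+
qed

end
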